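(* Let $G$ be a graph on $n$ vertices with no isolated vertices. Any two bicolorings of $G$ can be transformed into each other using at most $3n$ local inversions; that is, for any two bicolorings $\beta,\beta'$ of $G$ there is a string $w$ of vertices of $G$ with $|w|\le 3n$ such that $(G,\beta)_w=(G,\beta')$.
   Context: All graphs are finite, simple, undirected and labelled. A bicoloration (bicoloring) of a graph $G$ is a map $\beta:V(G)\to\{-1,1\}$, and a bicolored graph is a pair $B=(G,\beta)$. The local complement $G*a$ of $G$ at a vertex $a$ is obtained from $G$ by complementing the subgraph induced by the open neighborhood $N_G(a)$ and leaving all other adjacencies unchanged. The local inversion of $B=(G,\beta)$ at $a\in V(G)$ is $B_a=(G*a,\beta_a)$, where $\beta_a(x)=-\beta(x)$ if $x\in N_G(a)$ and $\beta_a(x)=\beta(x)$ otherwise. A string is a finite (possibly empty) sequence of vertices of $G$ (repetitions allowed); for a string $w=x_1\cdots x_k$ its length is $|w|=k$, and $B_w$ is the bicolored graph obtained from $B$ by applying the local inversions at $x_1,\ldots,x_k$ in this order, each neighborhood being taken in the current underlying graph. *)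

theory Defs
  imports "Graph_Theory.Pair_Digraph" "HOL-Library.FuncSet"
begin

text \<open>
  A finite simple undirected graph is a \<^locale>\<open>pair_graph\<close>: a finite vertex set with
  a symmetric, irreflexive set of ordered pairs, where an edge between \<open>x\<close> and \<open>y\<close>
  is represented by both \<open>(x, y)\<close> and \<open>(y, x)\<close>.
\<close>

definition nbhd :: "'a pair_pre_digraph \<Rightarrow> 'a \<Rightarrow> 'a set" where
  "nbhd G a = {x. (a, x) \<in> parcs G}"

definition isolated :: "'a pair_pre_digraph \<Rightarrow> 'a \<Rightarrow> bool" where
  "isolated G a \<longleftrightarrow> a \<in> pverts G \<and> nbhd G a = {}"

definition local_complement :: "'a pair_pre_digraph \<Rightarrow> 'a \<Rightarrow> 'a pair_pre_digraph" where
  "local_complement G a =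
     \<lparr> pverts = pverts G,
       parcs = {(x, y). if x \<in> nbhd G a \<and> y \<in> nbhd G a
                        then x \<noteq> y \<and> (x, y) \<notin> parcs G
                        else (x, y) \<in> parcs G} \<rparr>"

text \<open>
  Bicolorings are extensional functions (\<^const>\<open>undefined\<close> off the vertex set), so that
  equality of functions is equality of bicolorings; local inversion preserves this.
\<close>

definition bicolorings :: "'a pair_pre_digraph \<Rightarrow> ('a \<Rightarrow> int) set" where
  "bicolorings G = pverts G \<rightarrow>\<^sub>E {-1, 1}"

type_synonym 'a bicolored_graph = "'a pair_pre_digraph \<times> ('a \<Rightarrow> int)"

fun local_inversion :: "'a bicolored_graph \<Rightarrow> 'a \<Rightarrow> 'a bicolored_graph" where
  "local_inversion (G, \<beta>) a =
     (local_complement G a, \<lambda>x. if x \<in> nbhd G a then - \<beta> x else \<beta> x)"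

definition local_inversions :: "'a bicolored_graph \<Rightarrow> 'a list \<Rightarrow> 'a bicolored_graph" where
  "local_inversions B w = foldl local_inversion B w"

end

theory Submission
  imports Defs "HOL-Combinatorics.Transposition"
begin

text \<open>
  Local inversions change colors by sign flips that depend on the underlying graphs only. The
  theorem therefore asks for strings \<open>w\<close> that lead from \<open>G\<close> back to \<open>G\<close> and flip exactly a
  prescribed vertex set \<open>S\<close>, namely the set where the two bicolorings differ. Such a string flips
  the same set whatever the initial coloring is, so these strings may be concatenated.

  Three facts supply the strings. A single inversion is its own inverse. If \<open>ab\<close> is an edge, then
  both \<open>aba\<close> and \<open>bab\<close> turn \<open>G\<close> into the graph pivoted at \<open>ab\<close>, where the first flips only \<open>a\<close>
  and the second only \<open>b\<close>; as pivoting at \<open>ab\<close> twice is the identity, \<open>ababab\<close> returns to \<open>G\<close>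
  and flips \<open>a\<close> and \<open>b\<close> (lemma \<open>transition_hexagon\<close>). If \<open>b\<close> and \<open>c\<close> are two neighbors of \<open>a\<close>,
  pivoting at \<open>ab\<close>, then \<open>bc\<close>, then \<open>ac\<close> is the identity as well; the free choice of the
  flipped end in each of the three pivots yields every odd subset of \<open>{a, b, c}\<close> with nine
  inversions (lemma \<open>three_vertices_odd_flip\<close>).

  These pieces are assembled by induction on a vertex set \<open>U\<close> that induces a connected subgraph,
  spending three inversions per vertex (lemma \<open>connected_on_flip\<close>). The engine is lemma
  \<open>connected_on_remove\<close>: for \<open>x \<in> U\<close>, the set \<open>U - {x}\<close> is connected in \<open>G\<close> or in \<open>G * x\<close>.
  A vertex \<open>x\<close> that is not to be flipped is dropped, at the cost of at most the two inversions
  at \<open>x\<close> that lead to \<open>G * x\<close> and back. If all of \<open>U\<close> is to be flipped, choose an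
  edge \<open>va\<close> with \<open>U - {v}\<close> connected, and let \<open>w\<close> flip \<open>U - {v, a}\<close> in \<open>G\<close> or in \<open>G * a\<close>. In
  the first case \<open>vavava\<close> followed by \<open>w\<close> has six letters more than \<open>w\<close>. In the second case the
  string is \<open>vavava\<close> followed by \<open>a w a\<close>, and cancelling the two adjacent letters \<open>a\<close> again
  leaves six letters more than \<open>w\<close>: three for each of \<open>v\<close> and \<open>a\<close>.

  The one request that this induction does not serve is to flip a single end of an edge \<open>ab\<close> with
  \<open>U = {a, b}\<close>. If \<open>U\<close> is a whole component, one inversion at the other end does it.
\<close>

section \<open>Local inversions as color flips\<close>

abbreviation adj :: "'a pair_pre_digraph \<Rightarrow> 'a \<Rightarrow> 'a \<Rightarrow> bool" where
  "adj G x y \<equiv> (x, y) \<in> parcs G"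

definition flip :: "'a set \<Rightarrow> ('a \<Rightarrow> int) \<Rightarrow> 'a \<Rightarrow> int" where
  "flip S \<beta> = (\<lambda>x. if x \<in> S then - \<beta> x else \<beta> x)"

lemma flip_flip: "flip T (flip S \<beta>) = flip (sym_diff S T) \<beta>"
  by (auto simp: flip_def)

text \<open>
  The flipped set \<open>S\<close> is the same for all colorings, and transitions compose for that reason. Letting
  \<open>\<beta>\<close> range over all functions, not just over bicolorings, spares side conditions.
\<close>
definition transition ::
    "'a pair_pre_digraph \<Rightarrow> 'a list \<Rightarrow> 'a pair_pre_digraph \<Rightarrow> 'a set \<Rightarrow> bool" where
  "transition G w H S \<longleftrightarrow> (\<forall>\<beta>. local_inversions (G, \<beta>) w = (H, flip S \<beta>))"

lemma transition_Nil: "transition G [] G {}"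
  by (simp add: transition_def local_inversions_def flip_def)

lemma transition_single: "transition G [a] (local_complement G a) (nbhd G a)"
  by (simp add: transition_def local_inversions_def flip_def)

lemma transition_append:
  assumes "transition G v H S" and "transition H w K T"
  shows "transition G (v @ w) K (sym_diff S T)"
  using assms by (simp add: transition_def local_inversions_def flip_flip)

lemma bidirected_adj_sym:
  "pair_bidirected_digraph G \<Longrightarrow> adj G x y \<longleftrightarrow> adj G y x"
  by (meson pair_bidirected_digraph.axioms(1) pair_sym_digraph.arcs_symmetric)

lemma bidirected_adj_irrefl: "pair_bidirected_digraph G \<Longrightarrow> \<not> adj G x x"
  by (metis pair_bidirected_digraph.axioms(2) pair_loopfree_digraph.no_loops')

lemma adj_local_complement:
  assumes "pair_bidirected_digraph G"
  shows "adj (local_complement G a) x y \<longleftrightarrow>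
    (adj G x y \<noteq> (x \<noteq> y \<and> adj G a x \<and> adj G a y))"
  using bidirected_adj_irrefl[OF assms] by (auto simp: local_complement_def nbhd_def)

lemma pverts_local_complement [simp]: "pverts (local_complement G a) = pverts G"
  by (simp add: local_complement_def)

lemma bidirected_local_complement:
  assumes "pair_bidirected_digraph G"
  shows "pair_bidirected_digraph (local_complement G a)"
proof -
  interpret pair_bidirected_digraph G by (fact assms)
  have wf: "x \<in> pverts G \<and> y \<in> pverts G" if "adj (local_complement G a) x y" for x y
    using that adj_local_complement[OF assms] in_arcsD1 in_arcsD2 by metis
  have sym: "adj (local_complement G a) y x" if "adj (local_complement G a) x y" for x y
    using that adj_local_complement[OF assms] bidirected_adj_sym[OF assms] by metis
  have irrefl: "\<not> adj (local_complement G a) x x" for x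
    using adj_local_complement[OF assms] bidirected_adj_irrefl[OF assms] by metis
  show ?thesis
  proof
    show "symmetric (with_proj (local_complement G a))"
      using sym by (auto simp: symmetric_def sym_def)
  qed (use wf irrefl in auto)
qed

lemma pair_pre_digraph_eqI:
  fixes G H :: "'a pair_pre_digraph"
  assumes "pverts G = pverts H" and "\<And>x y. adj G x y \<longleftrightarrow> adj H x y"
  shows "G = H"
  using assms by (intro pair_pre_digraph.equality) auto

lemma local_complement_involutive:
  assumes "pair_bidirected_digraph G"
  shows "local_complement (local_complement G a) a = G"
    and "nbhd (local_complement G a) a = nbhd G a"
proof -
  note adj = adj_local_complement[OF assms]
    adj_local_complement[OF bidirected_local_complement[OF assms]]
  show "local_complement (local_complement G a) a = G"
    by (rule pair_pre_digraph_eqI) (auto simp: adj bidirected_adj_irrefl[OF assms])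
  show "nbhd (local_complement G a) a = nbhd G a"
    by (auto simp: nbhd_def adj bidirected_adj_irrefl[OF assms])
qed

lemma transition_cancel:
  assumes "pair_bidirected_digraph G"
  shows "transition G (u @ a # a # w) H S \<longleftrightarrow> transition G (u @ w) H S"
proof -
  have "local_inversions (G, \<beta>) (u @ a # a # w) = local_inversions (G, \<beta>) (u @ w)" for \<beta>
    using assms
  proof (induction u arbitrary: G \<beta>)
    case Nil
    then show ?case
      by (simp add: local_inversions_def local_complement_involutive if_distrib cong: if_cong)
  next
    case (Cons x u)
    then show ?case
      using Cons.IH[OF bidirected_local_complement[OF Cons.prems]]
      by (simp add: local_inversions_def)
  qed
  then show ?thesis by (simp add: transition_def)
qed

text \<open>
  Inverting at \<open>x\<close> before and after \<open>w\<close> flips the neighborhood of \<open>x\<close> twice, because \<open>x\<close> has the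
  same neighbors in \<open>G * x\<close>. Hence strings found for \<open>G * x\<close> serve for \<open>G\<close> at the cost of two letters.
\<close>
lemma transition_conjugate:
  assumes "pair_bidirected_digraph G"
    and "transition (local_complement G x) w (local_complement G x) S"
  shows "transition G (x # w @ [x]) G S"
proof -
  have "transition (local_complement G x) [x] G (nbhd G x)"
    using transition_single[of "local_complement G x" x]
    by (simp add: local_complement_involutive[OF assms(1)])
  from transition_append[OF transition_append[OF transition_single assms(2)] this]
  have "transition G (x # w @ [x]) G (sym_diff (sym_diff (nbhd G x) S) (nbhd G x))"
    by simp
  moreover have "sym_diff (sym_diff (nbhd G x) S) (nbhd G x) = S"
    by auto
  ultimately show ?thesis by simp
qed

section \<open>Pivots\<close>

text \<open>
  Pivoting at an edge \<open>ab\<close> exchanges the labels \<open>a\<close> and \<open>b\<close>. Among the other vertices, it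
  complements the adjacencies between any two of the three classes of neighbors of \<open>a\<close> only, of \<open>b\<close>
  only, and of both. The exclusive disjunction expresses that \<open>x\<close> and \<open>y\<close> lie in two different
  classes: it is the determinant over the two-element field of their adjacencies to \<open>a\<close> and \<open>b\<close>.
\<close>
definition pivot :: "'a pair_pre_digraph \<Rightarrow> 'a \<Rightarrow> 'a \<Rightarrow> 'a pair_pre_digraph" where
  "pivot G a b =
     \<lparr> pverts = pverts G,
       parcs = {(x, y). adj G (transpose a b x) (transpose a b y) \<noteq>
         (x \<notin> {a, b} \<and> y \<notin> {a, b} \<and>
          (adj G a x \<and> adj G b y) \<noteq> (adj G b x \<and> adj G a y))} \<rparr>"

lemma pverts_pivot [simp]: "pverts (pivot G a b) = pverts G"
  by (simp add: pivot_def)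

lemma adj_pivot:
  "adj (pivot G a b) x y \<longleftrightarrow> adj G (transpose a b x) (transpose a b y) \<noteq>
     (x \<notin> {a, b} \<and> y \<notin> {a, b} \<and>
      (adj G a x \<and> adj G b y) \<noteq> (adj G b x \<and> adj G a y))"
  by (simp add: pivot_def)

lemma pivot_commute: "pivot G a b = pivot G b a"
  by (rule pair_pre_digraph_eqI) (auto simp: adj_pivot transpose_commute)

text \<open>
  The three neighborhoods met on the way are \<open>b\<close> with the classes \<open>A\<close> and \<open>D\<close>, then \<open>a\<close> with \<open>A\<close>
  and \<open>C\<close>, then \<open>b\<close> with \<open>C\<close> and \<open>D\<close>, where \<open>A\<close>, \<open>C\<close>, \<open>D\<close> are the neighbors of \<open>a\<close> only, of \<open>b\<close>
  only, and of both. All vertices but \<open>a\<close> are flipped an even number of times.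
\<close>
lemma transition_pivot:
  assumes G: "pair_bidirected_digraph G" and ab: "adj G a b"
  shows "transition G [a, b, a] (pivot G a b) {a}"
proof -
  define G1 where "G1 = local_complement G a"
  define G2 where "G2 = local_complement G1 b"
  define G3 where "G3 = local_complement G2 a"
  note sym = bidirected_adj_sym[OF G] and irr = bidirected_adj_irrefl[OF G]
  have "a \<noteq> b" using ab irr by metis
  have ba: "adj G b a" using ab sym by metis
  have bi1: "pair_bidirected_digraph G1" and bi2: "pair_bidirected_digraph G2"
    using G by (simp_all add: G1_def G2_def bidirected_local_complement)
  have adj1: "adj G1 x y \<longleftrightarrow> (adj G x y \<noteq> (x \<noteq> y \<and> adj G a x \<and> adj G a y))"
    and adj2: "adj G2 x y \<longleftrightarrow> (adj G1 x y \<noteq> (x \<noteq> y \<and> adj G1 b x \<and> adj G1 b y))"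
    and adj3: "adj G3 x y \<longleftrightarrow> (adj G2 x y \<noteq> (x \<noteq> y \<and> adj G2 a x \<and> adj G2 a y))"
    for x y
    by (simp_all only: G1_def G2_def G3_def adj_local_complement G bi1[unfolded G1_def]
        bi2[unfolded G2_def G1_def])
  have b1: "adj G1 b x \<longleftrightarrow> (adj G b x \<noteq> (b \<noteq> x \<and> adj G a x))" for x
    using ab by (simp add: adj1)
  have a2: "adj G2 a x \<longleftrightarrow> (x = b \<or> (x \<noteq> a \<and> adj G b x))" for x
    using ab ba irr \<open>a \<noteq> b\<close> by (auto simp: adj2 b1 adj1)
  have "G3 = pivot G a b"
  proof (rule pair_pre_digraph_eqI)
    show "pverts G3 = pverts (pivot G a b)" by (simp add: G3_def G2_def G1_def)
    show "adj G3 x y \<longleftrightarrow> adj (pivot G a b) x y" for x y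
      unfolding adj3 a2 adj2 b1 adj1 adj_pivot
      using ab ba irr[of a] irr[of b] irr[of x] \<open>a \<noteq> b\<close> sym[of a x] sym[of a y] sym[of b x] sym[of b y]
      by (cases "x = a"; cases "x = b"; cases "y = a"; cases "y = b"; cases "x = y")
         (simp_all, blast+)
  qed
  moreover have "sym_diff (sym_diff (nbhd G a) (nbhd G1 b)) (nbhd G2 a) = {a}"
    using ab ba irr[of a] irr[of b] \<open>a \<noteq> b\<close> by (auto simp: nbhd_def b1 a2)
  ultimately show ?thesis
    using transition_append[OF transition_append[OF transition_single transition_single]
        transition_single, of G a b a]
    by (simp add: G1_def G2_def G3_def)
qed

lemma transition_pivot_choice:
  assumes G: "pair_bidirected_digraph G" and ab: "adj G a b" and p: "p \<in> {a, b}"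
  obtains w where "set w \<subseteq> {a, b}" and "length w = 3" and "transition G w (pivot G a b) {p}"
proof -
  have "transition G [b, a, b] (pivot G a b) {b}"
    using transition_pivot[OF G, of b a] ab bidirected_adj_sym[OF G] pivot_commute by metis
  with transition_pivot[OF G ab] p show ?thesis
    by (auto intro: that[of "[a, b, a]"] that[of "[b, a, b]"])
qed

lemma bidirected_pivot:
  assumes G: "pair_bidirected_digraph G" and ab: "adj G a b"
  shows "pair_bidirected_digraph (pivot G a b)"
proof -
  have "pivot G a b = local_complement (local_complement (local_complement G a) b) a"
    using transition_pivot[OF assms] by (simp add: transition_def local_inversions_def)
  then show ?thesis by (simp add: G bidirected_local_complement)
qed

lemma pivot_involutive:
  assumes G: "pair_bidirected_digraph G" and ab: "adj G a b"
  shows "pivot (pivot G a b) a b = G"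
proof (rule pair_pre_digraph_eqI)
  note sym = bidirected_adj_sym[OF G] and irr = bidirected_adj_irrefl[OF G]
  have "a \<noteq> b" using ab irr by metis
  show "adj (pivot (pivot G a b) a b) x y \<longleftrightarrow> adj G x y" for x y
    unfolding adj_pivot
    using ab irr[of a] irr[of b] \<open>a \<noteq> b\<close> sym[of a b] sym[of a x] sym[of a y] sym[of b x] sym[of b y]
    by (cases "x = a"; cases "x = b"; cases "y = a"; cases "y = b") (simp_all, blast+)
qed simp

text \<open>
  The word \<open>ababab\<close> is \<open>aba\<close> followed by \<open>bab\<close>: two pivots at the same edge, the first of which
  flips \<open>a\<close> and the second \<open>b\<close>.
\<close>
lemma transition_hexagon:
  assumes G: "pair_bidirected_digraph G" and ab: "adj G a b"
  shows "transition G [a, b, a, b, a, b] G {a, b}"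
proof -
  have "a \<noteq> b" using ab bidirected_adj_irrefl[OF G] by metis
  have ba: "adj (pivot G a b) b a"
    using ab bidirected_adj_sym[OF G, of a b] by (simp add: adj_pivot)
  have "transition (pivot G a b) [b, a, b] G {b}"
    using transition_pivot[OF bidirected_pivot[OF G ab] ba]
    by (simp add: pivot_commute[of _ b a] pivot_involutive[OF G ab])
  from transition_append[OF transition_pivot[OF G ab] this] \<open>a \<noteq> b\<close>
  show ?thesis by (simp add: insert_Diff_if insert_commute)
qed

text \<open>
  In terms of principal pivot transforms of the adjacency matrix over the two-element field,
  successive pivots compose to the pivot at the symmetric difference of the vertex sets, and
  \<open>{a, b}\<close> and \<open>{b, c}\<close> give \<open>{a, c}\<close>. Adjacent in \<open>G\<close> or not, \<open>b\<close> and \<open>c\<close>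
  are adjacent after the pivot at \<open>ab\<close>, where \<open>b\<close> has taken the place of \<open>a\<close>.
\<close>
lemma pivot_triangle:
  assumes G: "pair_bidirected_digraph G"
    and ab: "adj G a b" and ac: "adj G a c" and bc: "b \<noteq> c"
  shows "adj (pivot G a b) b c" and "pivot (pivot G a b) b c = pivot G a c"
proof -
  note sym = bidirected_adj_sym[OF G] and irr = bidirected_adj_irrefl[OF G]
  have ne: "a \<noteq> b" "a \<noteq> c" using ab ac irr by metis+
  show "adj (pivot G a b) b c"
    using ac ne bc by (simp add: adj_pivot)
  show "pivot (pivot G a b) b c = pivot G a c"
  proof (rule pair_pre_digraph_eqI)
    have kinds: "z = a \<or> z = b \<or> z = c \<or> z \<noteq> a \<and> z \<noteq> b \<and> z \<noteq> c" for z by blast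
    show "adj (pivot (pivot G a b) b c) x y \<longleftrightarrow> adj (pivot G a c) x y" for x y
      using kinds[of x] kinds[of y] ne bc ne[symmetric] bc[symmetric] ab ac irr[of a] irr[of b] irr[of c]
      by (elim disjE)
        (simp_all add: adj_pivot sym[of b a] sym[of c a] sym[of c b]
          sym[of x a] sym[of y a] sym[of x b] sym[of y b] sym[of x c] sym[of y c], argo+)
  qed simp
qed

text \<open>
  Strings of the form \<open>ababab\<close> flip two vertices each and so reach even sets only; a round of three
  pivots gives the odd ones.
\<close>
lemma three_vertices_odd_flip:
  assumes G: "pair_bidirected_digraph G"
    and ab: "adj G a b" and ac: "adj G a c" and bc: "b \<noteq> c"
    and S: "S \<in> {{a}, {b}, {c}, {a, b, c}}"
  obtains w where "set w \<subseteq> {a, b, c}" and "length w = 9" and "transition G w G S"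
proof -
  have ne: "a \<noteq> b" "a \<noteq> c" using ab ac bidirected_adj_irrefl[OF G] by metis+
  \<comment> \<open>the ends to be flipped by the pivots at \<open>ab\<close>, \<open>bc\<close> and \<open>ac\<close>\<close>
  obtain p q r where pqr: "p \<in> {a, b}" "q \<in> {b, c}" "r \<in> {a, c}"
    and S_eq: "S = sym_diff (sym_diff {p} {q}) {r}"
  proof -
    from S consider "S = {a}" | "S = {b}" | "S = {c}" | "S = {a, b, c}" by blast
    then show ?thesis
    proof cases
      case 1
      show ?thesis by (rule that[of a c c]) (use 1 ne in auto)
    next
      case 2
      show ?thesis by (rule that[of b c c]) (use 2 bc in auto)
    next
      case 3
      show ?thesis by (rule that[of a c a]) (use 3 ne in auto)
    next
      case 4
      show ?thesis by (rule that[of a b c]) (use 4 ne bc in auto)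
    qed
  qed
  note tri = pivot_triangle[OF G ab ac bc]
  note bi1 = bidirected_pivot[OF G ab] and bi2 = bidirected_pivot[OF G ac]
  have "adj (pivot G a c) a c"
    using ac bidirected_adj_sym[OF G, of a c] by (simp add: adj_pivot)
  then obtain w3 where w3: "set w3 \<subseteq> {a, c}" "length w3 = 3" "transition (pivot G a c) w3 G {r}"
    using transition_pivot_choice[OF bi2 _ pqr(3)] pivot_involutive[OF G ac] by metis
  obtain w2 where w2: "set w2 \<subseteq> {b, c}" "length w2 = 3"
      "transition (pivot G a b) w2 (pivot G a c) {q}"
    using transition_pivot_choice[OF bi1 tri(1) pqr(2)] tri(2) by metis
  obtain w1 where w1: "set w1 \<subseteq> {a, b}" "length w1 = 3" "transition G w1 (pivot G a b) {p}"
    using transition_pivot_choice[OF G ab pqr(1)] .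
  from transition_append[OF transition_append[OF w1(3) w2(3)] w3(3)]
  have "transition G ((w1 @ w2) @ w3) G S" by (simp only: S_eq)
  moreover have "set ((w1 @ w2) @ w3) \<subseteq> {a, b, c}" using w1 w2 w3 by auto
  ultimately show ?thesis
    using w1(2) w2(2) w3(2) by (intro that[of "(w1 @ w2) @ w3"]) simp_all
qed

section \<open>Connected vertex sets\<close>

text \<open>
  Connectedness of the induced subgraph is expressed by cuts, not by paths, since local
  complementation acts on the edges that cross a cut in a transparent way. The empty set is
  connected in this sense.
\<close>
definition connected_on :: "'a pair_pre_digraph \<Rightarrow> 'a set \<Rightarrow> bool" where
  "connected_on G U \<longleftrightarrow> (\<forall>A. A \<noteq> {} \<and> A \<subset> U \<longrightarrow> (\<exists>x\<in>A. \<exists>y\<in>U - A. adj G x y))"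

lemma connected_on_cutE:
  assumes "connected_on G U" and "A \<noteq> {}" and "A \<subset> U"
  obtains x y where "x \<in> A" and "y \<in> U - A" and "adj G x y"
  using assms unfolding connected_on_def by meson

lemma not_connected_onE:
  assumes "\<not> connected_on G U"
  obtains A where "A \<noteq> {}" and "A \<subset> U" and "\<And>x y. x \<in> A \<Longrightarrow> y \<in> U - A \<Longrightarrow> \<not> adj G x y"
  using assms unfolding connected_on_def by meson

text \<open>
  Suppose that a cut \<open>A\<close> of \<open>U - {x}\<close> is crossed by no edge of \<open>G\<close>, and a cut \<open>C\<close> by no edge of
  \<open>G * x\<close>. As \<open>U\<close> is connected, \<open>x\<close> has neighbors on both sides of \<open>A\<close>, and in \<open>G * x\<close> all those
  on one side are joined to all those on the other. So all neighbors of \<open>x\<close> lie on the same side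
  of \<open>C\<close>. The other side \<open>D\<close> contains no neighbor of \<open>x\<close>; edges at \<open>D\<close> are therefore the same in
  \<open>G\<close> and \<open>G * x\<close>, and \<open>D\<close> is separated in \<open>G\<close> from the rest of \<open>U\<close>.
\<close>
lemma connected_on_remove:
  assumes G: "pair_bidirected_digraph G" and U: "connected_on G U" and x: "x \<in> U"
  shows "connected_on G (U - {x}) \<or> connected_on (local_complement G x) (U - {x})"
proof (rule ccontr)
  note sym = bidirected_adj_sym[OF G]
  let ?W = "U - {x}"
  assume "\<not> ?thesis"
  then have notG: "\<not> connected_on G ?W" and notGx: "\<not> connected_on (local_complement G x) ?W"
    by simp_all
  obtain A where A: "A \<noteq> {}" "A \<subset> ?W" and noA: "\<And>u v. u \<in> A \<Longrightarrow> v \<in> ?W - A \<Longrightarrow> \<not> adj G u v"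
    by (rule not_connected_onE[OF notG]) blast
  obtain C where C: "C \<noteq> {}" "C \<subset> ?W"
    and noC: "\<And>u v. u \<in> C \<Longrightarrow> v \<in> ?W - C \<Longrightarrow> \<not> adj (local_complement G x) u v"
    by (rule not_connected_onE[OF notGx]) blast
  have nbr: "\<exists>u\<in>B. adj G x u"
    if B: "B \<noteq> {}" "B \<subset> ?W" and noB: "\<And>u v. u \<in> B \<Longrightarrow> v \<in> ?W - B \<Longrightarrow> \<not> adj G u v" for B
  proof -
    obtain u v where "u \<in> B" "v \<in> U - B" "adj G u v"
      using connected_on_cutE[OF U, of B] B by blast
    with noB have "v = x" by blast
    with \<open>u \<in> B\<close> \<open>adj G u v\<close> sym show ?thesis by blast
  qed
  obtain a where a: "a \<in> A" "adj G x a" using nbr[OF A noA] by blast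
  obtain b where b: "b \<in> ?W - A" "adj G x b"
  proof -
    have "\<exists>u\<in>?W - A. adj G x u"
    proof (rule nbr)
      show "\<not> adj G u v" if "u \<in> ?W - A" "v \<in> ?W - (?W - A)" for u v
        using that noA[of v u] sym[of u v] by blast
    qed (use A in auto)
    then show ?thesis using that by blast
  qed
  have across: "adj (local_complement G x) u v"
    if "u \<in> A" "v \<in> ?W - A" "adj G x u" "adj G x v" for u v
    using that noA[of u v] by (auto simp: adj_local_complement[OF G])
  have sym': "adj (local_complement G x) u v = adj (local_complement G x) v u" for u v
    by (rule bidirected_adj_sym[OF bidirected_local_complement[OF G]])
  have same: "(u \<in> C) = (v \<in> C)" if "u \<in> A" "v \<in> ?W - A" "adj G x u" "adj G x v" for u v
    using across[OF that] that A noC[of u v] noC[of v u] sym'[of u v] by blast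
  have side: "(u \<in> C) = (a \<in> C)" if "u \<in> ?W" "adj G x u" for u
    using same[of u b] same[of a b] same[of a u] a b that by blast
  obtain D where D: "D \<noteq> {}" "D \<subset> ?W" "\<And>u. u \<in> D \<Longrightarrow> \<not> adj G x u"
    and noD: "\<And>u v. u \<in> D \<Longrightarrow> v \<in> ?W - D \<Longrightarrow> \<not> adj (local_complement G x) u v"
  proof (cases "a \<in> C")
    case True
    show ?thesis
    proof (rule that[of "?W - C"])
      show "\<not> adj G x u" if "u \<in> ?W - C" for u
        using that side[of u] True by blast
      show "\<not> adj (local_complement G x) u v" if "u \<in> ?W - C" "v \<in> ?W - (?W - C)" for u v
        using that noC[of v u] sym'[of u v] by blast
    qed (use C in auto)
  next
    case False
    show ?thesis
    proof (rule that[of C])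
      show "\<not> adj G x u" if "u \<in> C" for u
        using that side[of u] False C(2) by blast
    qed (use C noC in auto)
  qed
  have "\<not> adj G u v" if "u \<in> D" "v \<in> ?W - D" for u v
    using noD[OF that] D(3)[OF that(1)] by (auto simp: adj_local_complement[OF G])
  from nbr[OF D(1,2) this] D(3) show False by blast
qed

lemma connected_on_insert:
  assumes G: "pair_bidirected_digraph G" and W: "connected_on G W" and w: "w \<in> W" "adj G w y"
  shows "connected_on G (insert y W)"
  unfolding connected_on_def
proof (intro allI impI)
  note sym = bidirected_adj_sym[OF G]
  fix A assume A: "A \<noteq> {} \<and> A \<subset> insert y W"
  consider "A \<inter> W = {}" | "W \<subseteq> A" | "A \<inter> W \<noteq> {}" "A \<inter> W \<subset> W" by blast
  then show "\<exists>u\<in>A. \<exists>v\<in>insert y W - A. adj G u v"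
  proof cases
    case 1
    with A have "A = {y}" by blast
    then show ?thesis using w 1 sym[of w y] by blast
  next
    case 2
    then have "y \<notin> A" using A by blast
    then show ?thesis using w 2 by blast
  next
    case 3
    then show ?thesis by (rule connected_on_cutE[OF W]) blast
  qed
qed

text \<open>
  A largest connected nonempty proper subset \<open>W\<close> of \<open>U\<close> misses one vertex only, as it can be
  enlarged by the far end of any edge that leaves it.
\<close>
lemma connected_on_noncut_vertex:
  assumes G: "pair_bidirected_digraph G" and U: "connected_on G U" "finite U" "2 \<le> card U"
  obtains a v where "v \<in> U" and "a \<in> U - {v}" and "adj G a v" and "connected_on G (U - {v})"
proof -
  let ?P = "\<lambda>W. W \<noteq> {} \<and> W \<subset> U \<and> connected_on G W"
  obtain u where u: "u \<in> U" using U(3) by fastforce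
  moreover have "{u} \<noteq> U" using U(3) by auto
  moreover have "connected_on G {u}" by (auto simp: connected_on_def)
  ultimately have P: "?P {u}" by auto
  have "\<forall>W. ?P W \<longrightarrow> card W < Suc (card U)"
    using U(2) by (auto simp: less_Suc_eq intro: psubset_card_mono)
  with P obtain W where W: "?P W" and max: "\<And>W'. ?P W' \<Longrightarrow> card W' \<le> card W"
    using ex_has_greatest_nat[of ?P "{u}" card "Suc (card U)"] by (metis less_imp_le)
  obtain a v where av: "a \<in> W" "v \<in> U - W" "adj G a v"
    using connected_on_cutE[OF U(1)] W by metis
  have "connected_on G (insert v W)"
    using connected_on_insert[OF G _ av(1,3)] W by blast
  moreover have "card (insert v W) > card W"
    using W av(2) U(2) by (metis DiffD2 card_insert_disjoint finite_subset lessI psubset_imp_subset)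
  moreover have "insert v W \<subseteq> U" using W av(2) by blast
  ultimately have "insert v W = U"
    using max[of "insert v W"] by (metis insert_not_empty not_le psubsetI)
  then have "U - {v} = W" using av by auto
  then show ?thesis using that[of v a] av W by blast
qed

section \<open>Flipping within a connected set\<close>

text \<open>
  The excluded case of \<open>card U = 2\<close> and \<open>card S = 1\<close> can fail: inversions at the two middle
  vertices of a path on four vertices run through a cycle of six different graphs, so a string of
  them that returns to the path flips both middle vertices or neither. Dropping unflipped vertices
  must stop before this case arises, whence the separate treatment of the odd subsets of a
  three-element \<open>U\<close>.
\<close>
lemma connected_on_flip:
  assumes "pair_bidirected_digraph G" and "connected_on G U" and "finite U" and "S \<subseteq> U"
    and "3 \<le> card U \<or> card S \<noteq> 1"
  shows "\<exists>w. set w \<subseteq> U \<and> length w \<le> 3 * card U \<and> transition G w G S"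
  using assms
proof (induction "card U" arbitrary: G U S rule: less_induct)
  case less
  note G = less.prems(1) and U = less.prems(2) and fin = less.prems(3) and S = less.prems(4)
  have finS: "finite S" using fin S finite_subset by blast
  consider "S = {}" | "card U = 2" "S = U" | "card U = 3" "odd (card S)"
    | "S \<subset> U" "3 \<le> card U - 1 \<or> card S \<noteq> 1" | "4 \<le> card U" "S = U"
  proof -
    show ?thesis
    proof (cases "S = U")
      case True
      have "card S = 0 \<longleftrightarrow> S = {}" using finS by simp
      then have "S = {} \<or> card U = 2 \<or> card U = 3 \<or> 4 \<le> card U"
        using less.prems(5) unfolding True by linarith
      then show ?thesis using that(1,2,3,5) True by (elim disjE) simp_all
    next
      case False
      then have "S \<subset> U" using S by blast
      moreover have "card U = 3 \<and> card S = 1 \<or> 3 \<le> card U - 1 \<or> card S \<noteq> 1"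
        using less.prems(5) by linarith
      ultimately show ?thesis using that(3,4) by (elim disjE) simp_all
    qed
  qed
  then show ?case
  proof cases
    case 1
    then show ?thesis using transition_Nil by (intro exI[of _ "[]"]) auto
  next
    case 2
    then obtain a b where ab: "U = {a, b}" "a \<noteq> b" by (meson card_2_iff)
    then obtain x y where "x \<in> {a}" "y \<in> U - {a}" "adj G x y"
      using connected_on_cutE[OF U, of "{a}"] by blast
    then have "adj G a b" using ab by auto
    from transition_hexagon[OF G this] 2 ab show ?thesis
      by (intro exI[of _ "[a, b, a, b, a, b]"]) auto
  next
    case 3
    have "2 \<le> card U" using 3 by simp
    from connected_on_noncut_vertex[OF G U fin this]
    obtain a v where v: "v \<in> U" and a: "a \<in> U - {v}" and av: "adj G a v"
      and conn: "connected_on G (U - {v})" .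
    have "card (U - {v} - {a}) = 1" using 3 v a fin by simp
    then obtain c where c: "U - {v} - {a} = {c}" using card_1_singletonE by blast
    then have U_eq: "U = {v, a, c}" and ne: "c \<noteq> v" "c \<noteq> a" "a \<noteq> v" using v a by blast+
    have cut: "{a} \<noteq> {}" "{a} \<subset> U - {v}" using U_eq ne by blast+
    obtain x y where "x \<in> {a}" "y \<in> U - {v} - {a}" "adj G x y"
      by (rule connected_on_cutE[OF conn cut])
    then have ac: "adj G a c" unfolding c by simp
    have "S \<in> {{a}, {v}, {c}, {a, v, c}}"
    proof -
      have "S \<in> Pow {v, a, c}" using S U_eq by simp
      then have "S \<in> {{}, {v}, {a}, {c}, {v, a}, {v, c}, {a, c}, {v, a, c}}"
        by (auto simp: Pow_insert)
      then show ?thesis using 3(2) ne by (auto simp: insert_commute)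
    qed
    from three_vertices_odd_flip[OF G av ac ne(1)[symmetric] this]
    obtain w where "set w \<subseteq> {a, v, c}" "length w = 9" "transition G w G S" .
    then show ?thesis using 3 U_eq by (intro exI[of _ w]) auto
  next
    case 4
    then obtain x where x: "x \<in> U" "x \<notin> S" by blast
    have card: "card (U - {x}) = card U - 1" "card U > 0" using x fin by (auto simp: card_gt_0_iff)
    have IH: "\<exists>w. set w \<subseteq> U - {x} \<and> length w \<le> 3 * card (U - {x}) \<and> transition H w H S"
      if "pair_bidirected_digraph H" "connected_on H (U - {x})" for H
      using less.hyps[of "U - {x}" H S] that card fin S x 4(2) by auto
    from connected_on_remove[OF G U x(1)] show ?thesis
    proof
      assume "connected_on G (U - {x})"
      from IH[OF G this] obtain w where "set w \<subseteq> U - {x}"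
        "length w \<le> 3 * card (U - {x})" "transition G w G S" by blast
      then show ?thesis using card by (intro exI[of _ w]) auto
    next
      assume "connected_on (local_complement G x) (U - {x})"
      from IH[OF bidirected_local_complement[OF G] this] obtain w where w: "set w \<subseteq> U - {x}"
        "length w \<le> 3 * card (U - {x})"
        "transition (local_complement G x) w (local_complement G x) S" by blast
      show ?thesis using w card x transition_conjugate[OF G w(3)]
        by (intro exI[of _ "x # w @ [x]"]) auto
    qed
  next
    case 5
    have "2 \<le> card U" using 5 by simp
    from connected_on_noncut_vertex[OF G U fin this]
    obtain a v where v: "v \<in> U" and a: "a \<in> U - {v}" and av: "adj G a v"
      and conn: "connected_on G (U - {v})" .
    let ?W = "U - {v} - {a}"
    have cW: "card ?W = card U - 2" using v a fin by simp
    have va: "adj G v a" using av bidirected_adj_sym[OF G] by metis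
    have U_eq: "sym_diff {v, a} ?W = U" using v a by auto
    have IH: "\<exists>w. set w \<subseteq> ?W \<and> length w \<le> 3 * card ?W \<and> transition H w H ?W"
      if "pair_bidirected_digraph H" "connected_on H ?W" for H
    proof (rule less.hyps)
      show "card ?W < card U" "3 \<le> card ?W \<or> card ?W \<noteq> 1" using cW 5(1) by linarith+
    qed (use that fin in auto)
    note hex = transition_hexagon[OF G va]
    from connected_on_remove[OF G conn a] show ?thesis
    proof
      assume "connected_on G ?W"
      from IH[OF G this] obtain w where w: "set w \<subseteq> ?W"
        "length w \<le> 3 * card ?W" "transition G w G ?W" by blast
      have "transition G ([v, a, v, a, v, a] @ w) G U"
        using transition_append[OF hex w(3)] unfolding U_eq .
      then show ?thesis using w cW 5 v a by (intro exI[of _ "[v, a, v, a, v, a] @ w"]) auto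
    next
      let ?H = "local_complement G a"
      assume "connected_on ?H ?W"
      from IH[OF bidirected_local_complement[OF G] this] obtain w where w: "set w \<subseteq> ?W"
        "length w \<le> 3 * card ?W" "transition ?H w ?H ?W" by blast
      have long: "transition G ([v, a, v, a, v, a] @ (a # w @ [a])) G U"
        using transition_append[OF hex transition_conjugate[OF G w(3)]] unfolding U_eq .
      \<comment> \<open>cancelling \<open>aa\<close> saves the two letters by which \<open>long\<close> exceeds the bound\<close>
      have "transition G ([v, a, v, a, v] @ w @ [a]) G U"
        using long transition_cancel[OF G, of "[v, a, v, a, v]" a "w @ [a]"] by simp
      then show ?thesis using w cW 5 v a by (intro exI[of _ "[v, a, v, a, v] @ w @ [a]"]) auto
    qed
  qed
qed

section \<open>Splitting into components\<close>

text \<open>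
  The case left open for connected sets is that of a component with two vertices: inverting at one
  end flips the other and complements a neighborhood with a single vertex, which changes no edge.
\<close>
lemma component_flip:
  assumes G: "pair_bidirected_digraph G" and C: "connected_on G C" "finite C" "2 \<le> card C"
    and closed: "\<And>x y. x \<in> C \<Longrightarrow> adj G x y \<Longrightarrow> y \<in> C" and S: "S \<subseteq> C"
  shows "\<exists>w. set w \<subseteq> C \<and> length w \<le> 3 * card C \<and> transition G w G S"
proof (cases "3 \<le> card C \<or> card S \<noteq> 1")
  case True
  then show ?thesis using connected_on_flip[OF G C(1,2) S] by blast
next
  case False
  then obtain a where a: "S = {a}" "a \<in> C" using S by (metis card_1_singletonE insert_subset)
  have "card (C - {a}) = 1" using False C a by simp
  then obtain b where b: "C - {a} = {b}" using card_1_singletonE by blast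
  have ba: "adj G b a"
    using connected_on_cutE[OF C(1), of "{b}"] a b by blast
  have C_eq: "C = {a, b}" using a b by blast
  have nb: "nbhd G b = {a}"
    using ba closed[of b] bidirected_adj_irrefl[OF G] unfolding C_eq nbhd_def by blast
  have "local_complement G b = G"
    by (rule pair_pre_digraph_eqI) (use nb in \<open>auto simp: local_complement_def bidirected_adj_irrefl[OF G]\<close>)
  then have "transition G [b] G S"
    using transition_single[of G b] nb a by simp
  then show ?thesis using b C(3) by (intro exI[of _ "[b]"]) auto
qed

text \<open>
  A minimal nonempty set that no edge leaves is connected, so it is a component. The string for it
  returns to \<open>G\<close>, after which the remaining components can be treated in \<open>G\<close> itself.
\<close>
lemma closed_set_flip:
  assumes G: "pair_bidirected_digraph G" and "finite U"
    and "\<And>x y. x \<in> U \<Longrightarrow> adj G x y \<Longrightarrow> y \<in> U" and "\<And>x. x \<in> U \<Longrightarrow> \<exists>y. adj G x y"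
    and "S \<subseteq> U"
  shows "\<exists>w. set w \<subseteq> U \<and> length w \<le> 3 * card U \<and> transition G w G S"
  using assms(2-)
proof (induction "card U" arbitrary: U S rule: less_induct)
  case less
  note fin = less.prems(1) and closed = less.prems(2) and nonisolated = less.prems(3)
    and S = less.prems(4)
  note sym = bidirected_adj_sym[OF G]
  let ?P = "\<lambda>C. C \<noteq> {} \<and> C \<subseteq> U \<and> (\<forall>x\<in>C. \<forall>y. adj G x y \<longrightarrow> y \<in> C)"
  show ?case
  proof (cases "U = {}")
    case True
    then show ?thesis using S transition_Nil by (intro exI[of _ "[]"]) auto
  next
    case False
    then have "?P U" using closed by blast
    from ex_has_least_nat[of ?P U card, OF this]
    obtain C where least: "?P C \<and> (\<forall>C'. ?P C' \<longrightarrow> card C \<le> card C')"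
      by (rule exE)
    have C: "?P C" using least by (rule conjunct1)
    have min: "card C \<le> card C'" if "?P C'" for C'
      using conjunct2[OF least] that by (elim allE impE)
    have finC: "finite C" using C fin finite_subset by blast
    have conn: "connected_on G C"
      unfolding connected_on_def
    proof (intro allI impI, rule ccontr)
      fix A assume A: "A \<noteq> {} \<and> A \<subset> C" and "\<not> (\<exists>x\<in>A. \<exists>y\<in>C - A. adj G x y)"
      then have "?P A" using C by blast
      then have "card C \<le> card A" by (rule min)
      moreover have "card A < card C" using A finC psubset_card_mono by blast
      ultimately show False by simp
    qed
    have "2 \<le> card C"
    proof -
      obtain x y where xy: "x \<in> C" "adj G x y" using C nonisolated by blast
      then have "{x, y} \<subseteq> C" "x \<noteq> y" using C bidirected_adj_irrefl[OF G] by blast+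
      then show ?thesis using card_mono[OF finC, of "{x, y}"] by simp
    qed
    then obtain v where v: "set v \<subseteq> C" "length v \<le> 3 * card C" "transition G v G (S \<inter> C)"
      using component_flip[OF G conn finC, of "S \<inter> C"] C by blast
    have card: "card U = card C + card (U - C)"
      using C fin finC by (metis card_Diff_subset card_mono le_add_diff_inverse)
    obtain w where w: "set w \<subseteq> U - C" "length w \<le> 3 * card (U - C)" "transition G w G (S - C)"
    proof -
      have "\<exists>w. set w \<subseteq> U - C \<and> length w \<le> 3 * card (U - C) \<and> transition G w G (S - C)"
      proof (rule less.hyps)
        show "card (U - C) < card U" using card \<open>2 \<le> card C\<close> by simp
        show "y \<in> U - C" if "x \<in> U - C" "adj G x y" for x y
          using that C closed sym by blast
      qed (use fin nonisolated S in auto)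
      then show ?thesis using that by blast
    qed
    have "sym_diff (S \<inter> C) (S - C) = S" by auto
    with transition_append[OF v(3) w(3)] have "transition G (v @ w) G S" by simp
    then show ?thesis using v w C card by (intro exI[of _ "v @ w"]) auto
  qed
qed

theorem corollary2:
  fixes G :: "'a pair_pre_digraph" and n :: nat and \<beta> \<beta>' :: "'a \<Rightarrow> int"
  assumes "pair_graph G"
    and "card (pverts G) = n"
    and "\<not> (\<exists>v. isolated G v)"
    and "\<beta> \<in> bicolorings G" and "\<beta>' \<in> bicolorings G"
  shows "\<exists>w. set w \<subseteq> pverts G \<and> length w \<le> 3 * n \<and>
           local_inversions (G, \<beta>) w = (G, \<beta>')"
proof -
  interpret pair_graph G by (fact assms(1))
  let ?S = "{x \<in> pverts G. \<beta> x \<noteq> \<beta>' x}"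
  have "\<exists>w. set w \<subseteq> pverts G \<and> length w \<le> 3 * card (pverts G) \<and> transition G w G ?S"
  proof (rule closed_set_flip)
    show "pair_bidirected_digraph G" by unfold_locales
    show "\<exists>y. adj G x y" if "x \<in> pverts G" for x
      using that assms(3) by (auto simp: isolated_def nbhd_def)
  qed (auto simp: pair_finite_verts dest: in_arcsD2)
  then obtain w where w: "set w \<subseteq> pverts G" "length w \<le> 3 * n" "transition G w G ?S"
    using assms(2) by blast
  have "flip ?S \<beta> = \<beta>'"
  proof
    fix x
    show "flip ?S \<beta> x = \<beta>' x"
    proof (cases "x \<in> pverts G")
      case True
      then have "\<beta> x \<in> {-1, 1}" "\<beta>' x \<in> {-1, 1}"
        using assms(4,5) by (auto simp: bicolorings_def dest: PiE_mem)
      then show ?thesis using True by (auto simp: flip_def)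
    next
      case False
      then have "\<beta> x = undefined" "\<beta>' x = undefined"
        using assms(4,5) PiE_arb unfolding bicolorings_def by metis+
      then show ?thesis using False by (simp add: flip_def)
    qed
  qed
  with w show ?thesis by (auto simp: transition_def)
qed

end
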